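(* Let $\eta_t$ be a probability measure on $E$ and, for each $N\ge1$, let $\eta^N_t=\frac1N\sum_{i=1}^N\delta_{\xi^{N,i}_t}$ be the empirical measure of a random vector $(\xi_t^{N,1},\dots,\xi_t^{N,N})\in E^N$. Let $q\ge1$ and let $F:E^q\to\mathbb R$ be bounded and symmetric. Suppose that for all $j\ge2$ and all $f\in\mathcal B_0^{\mathrm{sym}}(E^j)$ there is a constant $C$, depending only on $t,j,\|f\|_\infty$ (not on $N$), such that $$\mathbb E\bigl(((\eta^N_t)^{\odot j}(f))^2\bigr)\le\frac C{N^j}\qquad (N\ge j).$$ Assume further that, for some $\sigma^2\ge0$, $$\sqrt N\,\eta^N_t(h^{(1)})=\sqrt N\bigl(\eta^N_t(F^{(1)})-\theta\bigr)\ \xrightarrow[N\to+\infty]{\text{law}}\ \mathcal N(0,\sigma^2),$$ where $\theta=\eta_t^{\otimes q}(F)$, $F^{(1)}(x_1)=\int_{E^{q-1}}F(x_1,x_2,\dots,x_q)\,\eta_t^{\otimes(q-1)}(dx_2,\dots,dx_q)$ and $h^{(1)}=F^{(1)}-\theta$. Then $$\sqrt N\bigl((\eta^N_t)^{\odot q}(F)-\theta\bigr)\ \xrightarrow[N\to+\infty]{\text{law}}\ \mathcal N(0,q^2\sigma^2).$$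
   Context: $E$ is a measurable space; functions are measurable. For $N\ge j$ and $f:E^j\to\mathbb R$, $$(\eta^N_t)^{\odot j}(f)=\frac1{(N)_j}\sum_sf(\xi_t^{N,s(1)},\dots,\xi_t^{N,s(j)}),$$ the sum being over injective maps $s:\{1,\dots,j\}\to\{1,\dots,N\}$, with $(N)_j=N!/(N-j)!$. $\mathcal B_0^{\mathrm{sym}}(E^j)$ denotes the set of bounded symmetric functions $f:E^j\to\mathbb R$ such that $\int_Ef(x_1,\dots,x_j)\,\eta_t(dx_j)=0$ for all $x_1,\dots,x_{j-1}$. The time $t$ is a fixed parameter. $\mathcal N(0,0)$ means the Dirac mass at $0$. *)

theory Defs
  imports "HOL-Probability.Probability" "HOL-Combinatorics.Permutations"
begin

text \<open>
  The power \<open>E\<^sup>j\<close> of a measurable space is the product over the index set \<open>{1..j}\<close>; its points are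
  functions on the naturals that are \<open>undefined\<close> outside \<open>{1..j}\<close>.
\<close>

abbreviation power_space :: "'e measure \<Rightarrow> nat \<Rightarrow> (nat \<Rightarrow> 'e) measure" where
  "power_space E j \<equiv> PiM {1..j} (\<lambda>_. E)"

definition symmetric_on :: "'e measure \<Rightarrow> nat \<Rightarrow> ((nat \<Rightarrow> 'e) \<Rightarrow> real) \<Rightarrow> bool" where
  "symmetric_on E j f \<longleftrightarrow>
     (\<forall>p x. p permutes {1..j} \<longrightarrow> x \<in> space (power_space E j) \<longrightarrow> f (x \<circ> p) = f x)"

definition bounded_sym :: "'e measure \<Rightarrow> nat \<Rightarrow> ((nat \<Rightarrow> 'e) \<Rightarrow> real) set" where
  "bounded_sym E j = {f. f \<in> borel_measurable (power_space E j) \<and>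
     bounded (f ` space (power_space E j)) \<and> symmetric_on E j f}"

definition B0_sym :: "'e measure \<Rightarrow> 'e measure \<Rightarrow> nat \<Rightarrow> ((nat \<Rightarrow> 'e) \<Rightarrow> real) set" where
  "B0_sym E \<eta> j = {f \<in> bounded_sym E j.
     \<forall>x \<in> space (power_space E (j - 1)). (\<integral>y. f (x(j := y)) \<partial>\<eta>) = 0}"

definition sup_norm :: "'e measure \<Rightarrow> nat \<Rightarrow> ((nat \<Rightarrow> 'e) \<Rightarrow> real) \<Rightarrow> real" where
  "sup_norm E j f = (SUP x \<in> space (power_space E j). \<bar>f x\<bar>)"

definition empirical_measure :: "'e measure \<Rightarrow> nat \<Rightarrow> (nat \<Rightarrow> 'e) \<Rightarrow> 'e measure" where
  "empirical_measure E N x = measure_of (space E) (sets E)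
     (\<lambda>A. ennreal (1 / real N) * (\<Sum>i\<in>{1..N}. emeasure (return E (x i)) A))"

text \<open>The value \<open>(\<eta>\<^sup>N)\<^sup>\<odot>\<^sup>j(f)\<close> for the empirical measure of the points \<open>x 1, \<dots>, x N\<close>.\<close>

definition empirical_odot :: "nat \<Rightarrow> (nat \<Rightarrow> 'e) \<Rightarrow> nat \<Rightarrow> ((nat \<Rightarrow> 'e) \<Rightarrow> real) \<Rightarrow> real" where
  "empirical_odot N x j f =
     (\<Sum>s \<in> {s \<in> {1..j} \<rightarrow>\<^sub>E {1..N}. inj_on s {1..j}}. f (\<lambda>i\<in>{1..j}. x (s i))) /
     (fact N / fact (N - j))"

definition mean_value :: "'e measure \<Rightarrow> nat \<Rightarrow> ((nat \<Rightarrow> 'e) \<Rightarrow> real) \<Rightarrow> real" where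
  "mean_value \<eta> q F = (\<integral>x. F x \<partial>(PiM {1..q} (\<lambda>_. \<eta>)))"

definition first_proj :: "'e measure \<Rightarrow> nat \<Rightarrow> ((nat \<Rightarrow> 'e) \<Rightarrow> real) \<Rightarrow> 'e \<Rightarrow> real" where
  "first_proj \<eta> q F x1 = (\<integral>y. F (y(1 := x1)) \<partial>(PiM {2..q} (\<lambda>_. \<eta>)))"

definition centred_proj :: "'e measure \<Rightarrow> nat \<Rightarrow> ((nat \<Rightarrow> 'e) \<Rightarrow> real) \<Rightarrow> 'e \<Rightarrow> real" where
  "centred_proj \<eta> q F x1 = first_proj \<eta> q F x1 - mean_value \<eta> q F"

text \<open>The second parameter of \<open>normal_law\<close> is the variance; \<open>normal_density\<close> takes the standard deviation.\<close>

definition normal_law :: "real \<Rightarrow> real \<Rightarrow> real measure" where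
  "normal_law m v =
     (if v = 0 then return borel m else density lborel (\<lambda>x. ennreal (normal_density m (sqrt v) x)))"

lemma empirical_measure_eq_distr:
  assumes N: "N \<ge> 1" and x: "\<And>i. i \<in> {1..N} \<Longrightarrow> x i \<in> space E"
  shows "empirical_measure E N x = distr (uniform_count_measure {1..N}) E x"
proof -
  let ?D = "distr (uniform_count_measure {1..N}) E x"
  have xm: "x \<in> measurable (uniform_count_measure {1..N}) E"
    using x by (auto simp: measurable_def space_uniform_count_measure sets_uniform_count_measure)
  have em: "emeasure ?D A = ennreal (1 / real N) * (\<Sum>i\<in>{1..N}. emeasure (return E (x i)) A)"
    if A: "A \<in> sets E" for A
  proof -
    let ?J = "{i\<in>{1..N}. x i \<in> A}"
    have "emeasure ?D A = emeasure (uniform_count_measure {1..N}) ?J"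
      using xm A by (subst emeasure_distr)
        (auto simp: space_uniform_count_measure intro!: arg_cong[where f="emeasure _"])
    also have "\<dots> = ennreal (real (card ?J) / real N)"
      by (subst emeasure_uniform_count_measure) auto
    also have "\<dots> = ennreal (1 / real N) * ennreal (real (card ?J))"
      by (subst ennreal_mult[symmetric]) (auto)
    also have "ennreal (real (card ?J)) = (\<Sum>i\<in>{1..N}. emeasure (return E (x i)) A)"
      using A by (simp add: indicator_def sum.If_cases Int_def ennreal_of_nat_eq_real_of_nat)
    finally show ?thesis .
  qed
  have "empirical_measure E N x = measure_of (space E) (sets E) (emeasure ?D)"
    unfolding empirical_measure_def
    by (rule measure_of_eq) (simp_all only: sets.space_closed sets.sigma_sets_eq em)
  also have "\<dots> = ?D"
    using measure_of_of_measure[of ?D] by simp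
  finally show ?thesis .
qed

lemma integral_empirical_measure:
  fixes h :: "'e \<Rightarrow> real"
  assumes "N \<ge> 1" and x: "\<And>i. i \<in> {1..N} \<Longrightarrow> x i \<in> space E" and "h \<in> borel_measurable E"
  shows "(\<integral>y. h y \<partial>(empirical_measure E N x)) = (\<Sum>i\<in>{1..N}. h (x i)) / real N"
proof -
  have xm: "x \<in> measurable (uniform_count_measure {1..N}) E"
    using x by (auto simp: measurable_def space_uniform_count_measure sets_uniform_count_measure)
  have "empirical_measure E N x = distr (uniform_count_measure {1..N}) E x"
    using assms(1) x by (rule empirical_measure_eq_distr)
  then have "(\<integral>y. h y \<partial>(empirical_measure E N x)) = (\<integral>i. h (x i) \<partial>(uniform_count_measure {1..N}))"
    using xm assms(3) by (simp only: integral_distr)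
  also have "\<dots> = (\<Sum>i\<in>{1..N}. h (x i)) / real N"
    by (subst integral_uniform_count_measure) simp_all
  finally show ?thesis .
qed

end

theory Submission
  imports Defs "HOL-Real_Asymp.Real_Asymp"
begin

text \<open>
  Inclusion-exclusion over the partial means of \<open>F\<close> gives the Hoeffding decomposition
  \<open>F = \<Sum>\<^sub>A H\<^sub>A\<close> over \<open>A \<subseteq> {1..q}\<close>, where \<open>H\<^sub>A\<close> depends on the coordinates in \<open>A\<close> only and integrates
  to \<open>0\<close> in each of them. By symmetry, averaging \<open>H\<^sub>A\<close> over injections into \<open>{1..N}\<close> only depends on
  \<open>card A\<close>: the empty set contributes \<open>\<theta>\<close>, the \<open>q\<close> singletons contribute \<open>q \<eta>\<^sup>N(h\<^sup>(\<^sup>1\<^sup>))\<close>, and each \<open>A\<close> with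
  \<open>card A \<ge> 2\<close> is of order \<open>1/N\<close> in \<open>L\<^sup>2\<close> by assumption. After multiplication by \<open>\<surd>N\<close> the last group
  vanishes in \<open>L\<^sup>1\<close>, which does not affect the limit of the characteristic functions.
\<close>

section \<open>Weak convergence under small perturbations\<close>

text \<open>With the common phase \<open>iexp b\<close> factored out, the distance is the chord 2
  |sin ((a - b) / 2)| of the unit circle, which is at most its arc.\<close>

lemma norm_iexp_diff_le: "cmod (iexp a - iexp b) \<le> \<bar>a - b\<bar>"
proof -
  have "iexp a - iexp b = iexp b * (iexp (a - b) - 1)"
    by (simp add: algebra_simps flip: exp_add)
  then have "cmod (iexp a - iexp b) = 2 * \<bar>sin ((a - b) / 2)\<bar>"
    using dist_exp_i_1[of "a - b"] by (simp add: norm_mult)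
  also have "\<dots> \<le> \<bar>a - b\<bar>"
    using abs_sin_x_le_abs_x[of "(a - b) / 2"] by simp
  finally show ?thesis .
qed

text \<open>Only the tail of a sequence matters for convergence of distribution functions. This
  permits laws at small indices to be replaced by genuine probability laws.\<close>

lemma weak_conv_m_cong_eventually:
  assumes "\<forall>\<^sub>F n in sequentially. M n = M' n"
  shows "weak_conv_m M \<mu> \<longleftrightarrow> weak_conv_m M' \<mu>"
proof -
  have "(\<lambda>n. cdf (M n) x) \<longlonglongrightarrow> l \<longleftrightarrow> (\<lambda>n. cdf (M' n) x) \<longlonglongrightarrow> l" for x l
    using assms by (intro tendsto_cong) (auto elim: eventually_mono)
  then show ?thesis
    unfolding weak_conv_m_def weak_conv_def by simp
qed

text \<open>Since x -> \<open>iexp (t * x)\<close> is |t|-Lipschitz, closeness of two variables in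
  L1 passes to their characteristic functions.\<close>

lemma (in prob_space) norm_char_diff_le:
  fixes X Y :: "'a \<Rightarrow> real"
  assumes [measurable]: "X \<in> borel_measurable M" "Y \<in> borel_measurable M"
    and int: "integrable M (\<lambda>\<omega>. X \<omega> - Y \<omega>)"
  shows "cmod (char (distr M borel X) t - char (distr M borel Y) t)
           \<le> \<bar>t\<bar> * expectation (\<lambda>\<omega>. \<bar>X \<omega> - Y \<omega>\<bar>)"
proof -
  have "char (distr M borel X) t - char (distr M borel Y) t
      = (\<integral>\<omega>. iexp (t * X \<omega>) - iexp (t * Y \<omega>) \<partial>M)"
    unfolding char_def by (subst (1 2) integral_distr) (auto intro!: integrable_iexp Bochner_Integration.integral_diff[symmetric])
  also have "cmod \<dots> \<le> (\<integral>\<omega>. cmod (iexp (t * X \<omega>) - iexp (t * Y \<omega>)) \<partial>M)"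
    by (rule integral_norm_bound)
  also have "\<dots> \<le> (\<integral>\<omega>. \<bar>t\<bar> * \<bar>X \<omega> - Y \<omega>\<bar> \<partial>M)"
  proof (intro integral_mono)
    show "integrable M (\<lambda>\<omega>. cmod (iexp (t * X \<omega>) - iexp (t * Y \<omega>)))"
      by (intro integrable_norm Bochner_Integration.integrable_diff integrable_iexp) auto
    show "cmod (iexp (t * X \<omega>) - iexp (t * Y \<omega>)) \<le> \<bar>t\<bar> * \<bar>X \<omega> - Y \<omega>\<bar>" for \<omega>
      using norm_iexp_diff_le[of "t * X \<omega>" "t * Y \<omega>"]
      by (simp only: abs_mult flip: right_diff_distrib)
  qed (use int in auto)
  finally show ?thesis by simp
qed

lemma char_distr_scale:
  assumes "sets M = sets borel"
  shows "char (distr M borel (\<lambda>x. c * x)) t = char M (t * c)"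
proof -
  have [measurable_cong]: "sets M = sets borel" by fact
  show ?thesis
    unfolding char_def by (subst integral_distr) (auto simp: mult_ac)
qed

text \<open>Slutsky's lemma in L1 form: the characteristic functions of \<open>X n\<close> and
  \<open>c * Y n\<close> differ by a null sequence, and Levy continuity translates between them and
  weak convergence. The hypotheses are eventual because the averages over injections are controlled
  for N >= q.\<close>

lemma weak_conv_m_scale_perturb:
  fixes X Y :: "nat \<Rightarrow> 'w \<Rightarrow> real"
  assumes ps: "\<forall>\<^sub>F n in sequentially. prob_space (P n)"
    and X: "\<forall>\<^sub>F n in sequentially. X n \<in> borel_measurable (P n)"
    and Y: "\<forall>\<^sub>F n in sequentially. Y n \<in> borel_measurable (P n)"
    and int: "\<forall>\<^sub>F n in sequentially. integrable (P n) (\<lambda>\<omega>. X n \<omega> - c * Y n \<omega>)"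
    and L1: "(\<lambda>n. \<integral>\<omega>. \<bar>X n \<omega> - c * Y n \<omega>\<bar> \<partial>P n) \<longlonglongrightarrow> 0"
    and \<mu>: "real_distribution \<mu>"
    and conv: "weak_conv_m (\<lambda>n. distr (P n) borel (Y n)) \<mu>"
  shows "weak_conv_m (\<lambda>n. distr (P n) borel (X n)) (distr \<mu> borel (\<lambda>x. c * x))"
proof -
  interpret \<mu>: real_distribution \<mu> by fact
  define good where "good n \<longleftrightarrow> prob_space (P n) \<and> X n \<in> borel_measurable (P n) \<and>
    Y n \<in> borel_measurable (P n) \<and> integrable (P n) (\<lambda>\<omega>. X n \<omega> - c * Y n \<omega>)" for n
  have good: "\<forall>\<^sub>F n in sequentially. good n"
    using ps X Y int by eventually_elim (auto simp: good_def)
  \<comment> \<open>Where the hypotheses fail, a Dirac mass stands in, since Levy continuity asks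
    for a probability law at every index.\<close>
  define MX where "MX n = (if good n then distr (P n) borel (X n) else return borel 0)" for n
  define MY where "MY n = (if good n then distr (P n) borel (Y n) else return borel 0)" for n
  have rd: "real_distribution (MX n)" "real_distribution (MY n)" for n
    unfolding MX_def MY_def real_distribution_def real_distribution_axioms_def good_def
    by (auto intro: prob_space.prob_space_distr prob_space_return)
  have "weak_conv_m MY \<mu>"
    using conv good by (subst weak_conv_m_cong_eventually[where M'="\<lambda>n. distr (P n) borel (Y n)"])
      (auto simp: MY_def elim: eventually_mono)
  then have charY: "(\<lambda>n. char (MY n) t) \<longlonglongrightarrow> char \<mu> t" for t
    using rd(2) \<mu> by (intro levy_continuity1)
  have "(\<lambda>n. char (MX n) t) \<longlonglongrightarrow> char (distr \<mu> borel (\<lambda>x. c * x)) t" for t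
  proof -
    have "\<forall>\<^sub>F n in sequentially. cmod (char (MX n) t - char (MY n) (t * c))
        \<le> \<bar>t\<bar> * (\<integral>\<omega>. \<bar>X n \<omega> - c * Y n \<omega>\<bar> \<partial>P n)"
      using good
    proof eventually_elim
      case (elim n)
      then interpret prob_space "P n" by (simp add: good_def)
      have [measurable]: "X n \<in> borel_measurable (P n)" "Y n \<in> borel_measurable (P n)"
        using elim by (auto simp: good_def)
      \<comment> \<open>The factor c passes into the frequency, so the limit of the
        \<open>MY n\<close> is used at t * c.\<close>
      have "char (MY n) (t * c) = char (distr (P n) borel (\<lambda>\<omega>. c * Y n \<omega>)) t"
        using elim by (simp add: MY_def char_def integral_distr mult_ac)
      then show ?case
        using elim norm_char_diff_le[of "X n" "\<lambda>\<omega>. c * Y n \<omega>" t] by (simp add: MX_def good_def)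
    qed
    then have "(\<lambda>n. char (MX n) t - char (MY n) (t * c)) \<longlonglongrightarrow> 0"
      using tendsto_mult_right_zero[OF L1] by (rule Lim_null_comparison)
    from tendsto_add[OF this charY[of "t * c"]] show ?thesis
      by (simp add: char_distr_scale)
  qed
  moreover have "real_distribution (distr \<mu> borel (\<lambda>x. c * x))"
    unfolding real_distribution_def real_distribution_axioms_def
    by (auto intro: \<mu>.prob_space_distr)
  ultimately have "weak_conv_m MX (distr \<mu> borel (\<lambda>x. c * x))"
    using rd(1) by (intro levy_continuity)
  then show ?thesis
    using good by (subst weak_conv_m_cong_eventually[where M'=MX])
      (auto simp: MX_def elim: eventually_mono)
qed

section \<open>Scaling of the normal law and first moments from second moments\<close>

lemma real_distribution_normal_law: "v \<ge> 0 \<Longrightarrow> real_distribution (normal_law m v)"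
  unfolding normal_law_def real_distribution_def real_distribution_axioms_def
  by (auto intro: prob_space_return prob_space_normal_density)

text \<open>The case v = 0 is separate because \<open>normal_law\<close> is then a Dirac mass.
  Otherwise the standard deviation sqrt v becomes |c| sqrt v, hence the variance c^2 v.\<close>

lemma distr_normal_law_scale:
  assumes "v \<ge> 0" "c \<noteq> 0"
  shows "distr (normal_law 0 v) borel (\<lambda>x. c * x) = normal_law 0 (c\<^sup>2 * v)"
proof (cases "v = 0")
  case True
  then show ?thesis by (simp add: normal_law_def distr_return)
next
  case False
  with assms have v: "sqrt v > 0" by simp
  let ?M = "density lborel (\<lambda>x. ennreal (normal_density 0 (sqrt v) x))"
  interpret prob_space ?M using v by (rule prob_space_normal_density)
  have "distributed ?M lborel (\<lambda>x. x) (normal_density 0 (sqrt v))"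
    by (auto simp: distributed_def intro!: distr_id2)
  from normal_density_affine[OF this v \<open>c \<noteq> 0\<close>, of 0]
  have "distr ?M lborel (\<lambda>x. c * x) = density lborel (normal_density 0 (\<bar>c\<bar> * sqrt v))"
    by (simp add: distributed_def)
  \<comment> \<open>The target measure enters \<open>distr\<close> only through its space and sets,
    on which \<open>lborel\<close> and \<open>borel\<close> agree.\<close>
  moreover have "distr ?M lborel (\<lambda>x. c * x) = distr ?M borel (\<lambda>x. c * x)"
    by (rule distr_cong) auto
  ultimately show ?thesis
    using False \<open>c \<noteq> 0\<close> by (simp add: normal_law_def real_sqrt_mult)
qed

text \<open>A one-parameter form of the Cauchy-Schwarz bound, from 0 <= (c |u| - 1)^2. With c = N it
  turns a second moment of order 1/N^2 into a first moment of order 1/N.\<close>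

lemma (in prob_space) expectation_abs_le_square:
  fixes U :: "'a \<Rightarrow> real"
  assumes U: "U \<in> borel_measurable M" and sq: "integrable M (\<lambda>\<omega>. (U \<omega>)\<^sup>2)" and "c > 0"
  shows "expectation (\<lambda>\<omega>. \<bar>U \<omega>\<bar>) \<le> (c * expectation (\<lambda>\<omega>. (U \<omega>)\<^sup>2) + 1 / c) / 2"
proof -
  have amgm: "\<bar>u\<bar> \<le> (c * u\<^sup>2 + 1 / c) / 2" for u
  proof -
    have "0 \<le> (c * \<bar>u\<bar> - 1)\<^sup>2 / (2 * c)" using \<open>c > 0\<close> by simp
    also have "\<dots> = (c * u\<^sup>2 + 1 / c) / 2 - \<bar>u\<bar>"
      using \<open>c > 0\<close> by (simp add: power2_eq_square field_simps)
    finally show ?thesis by simp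
  qed
  have "expectation (\<lambda>\<omega>. \<bar>U \<omega>\<bar>) \<le> expectation (\<lambda>\<omega>. (c * (U \<omega>)\<^sup>2 + 1 / c) / 2)"
  proof (rule integral_mono)
    show "integrable M (\<lambda>\<omega>. \<bar>U \<omega>\<bar>)"
      by (rule integrable_abs[OF square_integrable_imp_integrable[OF U sq]])
    show "integrable M (\<lambda>\<omega>. (c * (U \<omega>)\<^sup>2 + 1 / c) / 2)"
      using sq by simp
  qed (rule amgm)
  also have "\<dots> = (c * expectation (\<lambda>\<omega>. (U \<omega>)\<^sup>2) + 1 / c) / 2"
    using sq by (simp add: prob_space)
  finally show ?thesis .
qed

section \<open>Averages over injections\<close>

definition injections :: "nat \<Rightarrow> nat \<Rightarrow> (nat \<Rightarrow> nat) set" where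
  "injections j N = {s \<in> {1..j} \<rightarrow>\<^sub>E {1..N}. inj_on s {1..j}}"

lemma finite_injections [simp]: "finite (injections j N)"
  unfolding injections_def by (rule finite_subset[OF _ finite_PiE[of "{1..j}" "\<lambda>_. {1..N}"]]) auto

lemma empirical_odot_injections:
  "empirical_odot N x j f =
     (\<Sum>s \<in> injections j N. f (\<lambda>i\<in>{1..j}. x (s i))) / (fact N / fact (N - j))"
  by (simp add: empirical_odot_def injections_def)

text \<open>Splitting off the last value turns a sum over injections into a double sum with explicit
  fibres. The restriction in the inverse restores the default \<open>undefined\<close> at
  \<open>Suc j\<close>.\<close>

lemma bij_betw_injections_Suc:
  "bij_betw (\<lambda>(s, k). s(Suc j := k)) (SIGMA s : injections j N. {1..N} - s ` {1..j})
     (injections (Suc j) N)"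
proof (rule bij_betw_byWitness[where f'="\<lambda>s. (restrict s {1..j}, s (Suc j))"])
  have ins: "{1..Suc j} = insert (Suc j) {1..j}" by auto
  show "\<forall>a\<in>(SIGMA s : injections j N. {1..N} - s ` {1..j}).
      (restrict (case a of (s, k) \<Rightarrow> s(Suc j := k)) {1..j}, (case a of (s, k) \<Rightarrow> s(Suc j := k)) (Suc j)) = a"
    by (auto simp: injections_def PiE_iff extensional_def fun_eq_iff restrict_def)
  show "\<forall>a'\<in>injections (Suc j) N. (case (restrict a' {1..j}, a' (Suc j)) of (s, k) \<Rightarrow> s(Suc j := k)) = a'"
    by (auto simp: injections_def PiE_iff extensional_def fun_eq_iff restrict_def)
  show "(\<lambda>(s, k). s(Suc j := k)) ` (SIGMA s : injections j N. {1..N} - s ` {1..j}) \<subseteq> injections (Suc j) N"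
  proof safe
    fix s k assume s: "s \<in> injections j N" and k: "k \<in> {1..N}" "k \<notin> s ` {1..j}"
    have "s(Suc j := k) \<in> {1..Suc j} \<rightarrow>\<^sub>E {1..N}"
      unfolding ins using s k(1) by (intro PiE_fun_upd) (auto simp: injections_def)
    moreover have "inj_on (s(Suc j := k)) {1..Suc j}"
      unfolding ins using s k(2)
      by (auto simp: injections_def intro!: inj_on_fun_updI)
    ultimately show "s(Suc j := k) \<in> injections (Suc j) N"
      by (simp add: injections_def)
  qed
  show "(\<lambda>s. (restrict s {1..j}, s (Suc j))) ` injections (Suc j) N
      \<subseteq> (SIGMA s : injections j N. {1..N} - s ` {1..j})"
  proof (rule image_subsetI)
    fix s assume "s \<in> injections (Suc j) N"
    then have s: "s \<in> {1..Suc j} \<rightarrow>\<^sub>E {1..N}" "inj_on s {1..Suc j}"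
      by (auto simp: injections_def)
    have "restrict s {1..j} \<in> injections j N"
      using s by (auto simp: injections_def PiE_iff inj_on_restrict_eq intro: inj_on_subset)
    moreover have "s (Suc j) \<in> {1..N}"
      using s(1) by (auto simp: PiE_iff)
    moreover have "s (Suc j) \<notin> restrict s {1..j} ` {1..j}"
      using s(2) unfolding ins by auto
    ultimately show "(restrict s {1..j}, s (Suc j)) \<in> (SIGMA s : injections j N. {1..N} - s ` {1..j})"
      by simp
  qed
qed

text \<open>Each injection of \<open>{1..j}\<close> has exactly N - j extensions, and the
  normalisation (N)_(j+1) = (N)_j (N - j) absorbs this factor.\<close>

lemma empirical_odot_Suc_marginal:
  assumes g: "\<And>x y. (\<And>i. i \<in> {1..j} \<Longrightarrow> x i = y i) \<Longrightarrow> g x = g y"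
    and "Suc j \<le> N"
  shows "empirical_odot N x (Suc j) g = empirical_odot N x j g"
proof -
  have "(\<Sum>s \<in> injections (Suc j) N. g (\<lambda>i\<in>{1..Suc j}. x (s i)))
      = (\<Sum>(s, k) \<in> (SIGMA s : injections j N. {1..N} - s ` {1..j}).
          g (\<lambda>i\<in>{1..Suc j}. x ((s(Suc j := k)) i)))"
    by (subst sum.reindex_bij_betw[OF bij_betw_injections_Suc, symmetric])
       (simp add: case_prod_unfold)
  also have "\<dots> = (\<Sum>(s, k) \<in> (SIGMA s : injections j N. {1..N} - s ` {1..j}).
          g (\<lambda>i\<in>{1..j}. x (s i)))"
    by (intro sum.cong refl) (auto intro!: g)
  also have "\<dots> = (\<Sum>s \<in> injections j N. \<Sum>k \<in> {1..N} - s ` {1..j}. g (\<lambda>i\<in>{1..j}. x (s i)))"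
    by (subst sum.Sigma) auto
  also have "\<dots> = (\<Sum>s \<in> injections j N. real (N - j) * g (\<lambda>i\<in>{1..j}. x (s i)))"
  proof (intro sum.cong refl)
    fix s assume "s \<in> injections j N"
    then have "card ({1..N} - s ` {1..j}) = N - j"
      by (subst card_Diff_subset) (auto simp: injections_def card_image)
    then show "(\<Sum>k \<in> {1..N} - s ` {1..j}. g (\<lambda>i\<in>{1..j}. x (s i)))
        = real (N - j) * g (\<lambda>i\<in>{1..j}. x (s i))"
      by simp
  qed
  also have "\<dots> = real (N - j) * (\<Sum>s \<in> injections j N. g (\<lambda>i\<in>{1..j}. x (s i)))"
    by (simp add: sum_distrib_left)
  finally have sum: "(\<Sum>s \<in> injections (Suc j) N. g (\<lambda>i\<in>{1..Suc j}. x (s i)))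
      = real (N - j) * (\<Sum>s \<in> injections j N. g (\<lambda>i\<in>{1..j}. x (s i)))" .
  \<comment> \<open>\<open>Suc j \<le> N\<close> keeps the truncated difference positive, so that
    the factor N - j can be cancelled.\<close>
  have "N - j = Suc (N - Suc j)" using \<open>Suc j \<le> N\<close> by simp
  then have "(fact (N - j) :: real) = real (N - j) * fact (N - Suc j)"
    by simp
  then show ?thesis
    using \<open>Suc j \<le> N\<close> unfolding empirical_odot_injections sum by simp
qed

lemma empirical_odot_marginal:
  assumes g: "\<And>x y. (\<And>i. i \<in> {1..j} \<Longrightarrow> x i = y i) \<Longrightarrow> g x = g y"
    and "j \<le> q" "q \<le> N"
  shows "empirical_odot N x q g = empirical_odot N x j g"
  using assms(2,3)
proof (induction q rule: dec_induct)
  case (step n)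
  have "empirical_odot N x (Suc n) g = empirical_odot N x n g"
    using step.hyps step.prems by (intro empirical_odot_Suc_marginal g) auto
  then show ?case using step by simp
qed simp

text \<open>Precomposition with \<open>p\<close> is a bijection of the set of injections, inverted
  by precomposition with \<open>inv p\<close>, so the sum is merely reordered.\<close>

lemma empirical_odot_permute:
  assumes p: "p permutes {1..q}"
  shows "empirical_odot N x q (\<lambda>y. f (y \<circ> p)) = empirical_odot N x q f"
proof -
  have "bij_betw (\<lambda>s. s \<circ> p) (injections q N) (injections q N)"
  proof (rule bij_betw_byWitness[where f'="\<lambda>s. s \<circ> inv p"])
    have comp: "s \<circ> r \<in> injections q N" if "s \<in> injections q N" "r permutes {1..q}" for s r
      using that permutes_in_image[OF that(2)] permutes_not_in[OF that(2)]
      by (auto simp: injections_def PiE_iff extensional_def permutes_image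
          intro!: comp_inj_on permutes_inj_on[OF that(2)])
    show "(\<lambda>s. s \<circ> p) ` injections q N \<subseteq> injections q N"
      "(\<lambda>s. s \<circ> inv p) ` injections q N \<subseteq> injections q N"
      using comp p permutes_inv[OF p] by blast+
  qed (use permutes_inv_o[OF p] in \<open>auto simp: comp_assoc\<close>)
  from sum.reindex_bij_betw[OF this, of "\<lambda>s. f (\<lambda>i\<in>{1..q}. x (s i))"]
  have "(\<Sum>s\<in>injections q N. f (\<lambda>i\<in>{1..q}. x (s i)))
      = (\<Sum>s\<in>injections q N. f (\<lambda>i\<in>{1..q}. x ((s \<circ> p) i)))" by simp
  also have "\<dots> = (\<Sum>s\<in>injections q N. f ((\<lambda>i\<in>{1..q}. x (s i)) \<circ> p))"
    using permutes_in_image[OF p] by (intro sum.cong refl arg_cong[where f=f]) (auto simp: fun_eq_iff)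
  finally show ?thesis by (simp add: empirical_odot_injections)
qed

text \<open>A constant reads no coordinate, so it can be averaged over E^0, where the only injection
  is the empty one.\<close>

lemma empirical_odot_const:
  assumes "q \<le> N"
  shows "empirical_odot N x q (\<lambda>_. c) = c"
  using empirical_odot_marginal[of 0 "\<lambda>_. c" q N x] assms by (simp add: empirical_odot_def)

lemma empirical_odot_1:
  assumes "N \<ge> 1"
  shows "empirical_odot N x 1 g = (\<Sum>i\<in>{1..N}. g (\<lambda>k\<in>{1}. x i)) / real N"
proof -
  have "bij_betw (\<lambda>i. \<lambda>k\<in>{1}. i) {1..N} (injections 1 N)"
    by (rule bij_betw_byWitness[where f'="\<lambda>s. s 1"])
       (auto simp: injections_def PiE_iff extensional_def fun_eq_iff restrict_def)
  from sum.reindex_bij_betw[OF this, of "\<lambda>s. g (\<lambda>i\<in>{1}. x (s i))"]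
  have "(\<Sum>s\<in>injections 1 N. g (\<lambda>i\<in>{1}. x (s i))) = (\<Sum>i\<in>{1..N}. g (\<lambda>k\<in>{1}. x i))"
    by (simp add: restrict_def cong: if_cong)
  moreover have "(fact N :: real) / fact (N - 1) = real N"
    using assms by (simp add: fact_reduce)
  ultimately show ?thesis by (simp add: empirical_odot_injections)
qed

lemma empirical_odot_sum:
  "empirical_odot N x q (\<lambda>y. \<Sum>A\<in>I. f A y) = (\<Sum>A\<in>I. empirical_odot N x q (f A))"
  unfolding empirical_odot_def sum_divide_distrib[symmetric]
  by (subst sum.swap) simp

lemma empirical_odot_cong:
  assumes "\<And>i. i \<in> {1..N} \<Longrightarrow> x i \<in> space E"
    and "\<And>y. y \<in> space (power_space E q) \<Longrightarrow> f y = g y"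
  shows "empirical_odot N x q f = empirical_odot N x q g"
proof -
  have "(\<lambda>i\<in>{1..q}. x (s i)) \<in> space (power_space E q)" if "s \<in> injections q N" for s
    using that assms(1) by (auto simp: injections_def space_PiM PiE_iff)
  then show ?thesis
    unfolding empirical_odot_injections using assms(2) by (simp cong: sum.cong)
qed

lemma borel_measurable_empirical_odot:
  assumes \<xi>: "\<And>i. i \<in> {1..N} \<Longrightarrow> \<xi> i \<in> measurable M E"
    and f: "f \<in> borel_measurable (power_space E j)"
  shows "(\<lambda>\<omega>. empirical_odot N (\<lambda>i. \<xi> i \<omega>) j f) \<in> borel_measurable M"
proof -
  have "(\<lambda>\<omega>. f (\<lambda>i\<in>{1..j}. \<xi> (s i) \<omega>)) \<in> borel_measurable M" if "s \<in> injections j N" for s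
  proof (rule measurable_compose[OF _ f], rule measurable_restrict)
    fix i assume "i \<in> {1..j}"
    with that show "\<xi> (s i) \<in> measurable M E"
      by (intro \<xi>) (auto simp: injections_def PiE_iff)
  qed
  then show ?thesis
    unfolding empirical_odot_injections by measurable
qed

lemma abs_empirical_odot_le:
  assumes x: "\<And>i. i \<in> {1..N} \<Longrightarrow> x i \<in> space E"
    and f: "\<And>y. y \<in> space (power_space E j) \<Longrightarrow> \<bar>f y\<bar> \<le> c" and "j \<le> N"
  shows "\<bar>empirical_odot N x j f\<bar> \<le> c"
proof -
  let ?d = "fact N / fact (N - j) :: real"
  have "(\<lambda>i\<in>{1..j}. x (s i)) \<in> space (power_space E j)" if "s \<in> injections j N" for s
    using that x by (auto simp: injections_def space_PiM PiE_iff)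
  then have "\<bar>\<Sum>s\<in>injections j N. f (\<lambda>i\<in>{1..j}. x (s i))\<bar> \<le> (\<Sum>s\<in>injections j N. c)"
    using f by (intro order_trans[OF sum_abs] sum_mono) auto
  then have "\<bar>empirical_odot N x j f\<bar> \<le> (\<Sum>s\<in>injections j N. c) / ?d"
    unfolding empirical_odot_injections abs_divide[of _ ?d] by (simp add: divide_right_mono)
  \<comment> \<open>Instead of counting injections, the quotient is read back as the average of the
    constant c.\<close>
  also have "\<dots> = empirical_odot N x j (\<lambda>_. c)"
    by (simp add: empirical_odot_injections)
  also have "\<dots> = c" using \<open>j \<le> N\<close> by (rule empirical_odot_const)
  finally show ?thesis .
qed

section \<open>The Hoeffding decomposition\<close>

text \<open>Overwriting coordinate i of a product sample by an independent draw from
  \<open>M i\<close> preserves the product law; Fubini then isolates the integral over the new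
  draw.\<close>

lemma integral_PiM_resample:
  fixes G :: "('i \<Rightarrow> 'a) \<Rightarrow> real"
  assumes M: "\<And>i. i \<in> I \<Longrightarrow> prob_space (M i)" and "i \<in> I"
    and G: "integrable (PiM I M) G"
  shows "(\<integral>y. (\<integral>z. G (z(i := y)) \<partial>PiM I M) \<partial>M i) = (\<integral>z. G z \<partial>PiM I M)"
proof -
  interpret Mi: prob_space "M i" using assms by auto
  interpret I: prob_space "PiM I M" using M by (rule prob_space_PiM)
  interpret pair_sigma_finite "M i" "PiM I M" ..
  \<comment> \<open>As i already lies in I, the rule for adjoining a coordinate to a product becomes
    a rule for replacing one.\<close>
  have ins: "insert i I = I" using \<open>i \<in> I\<close> by auto
  have upd: "(\<lambda>(y, z). z(i := y)) \<in> measurable (M i \<Otimes>\<^sub>M PiM I M) (PiM I M)"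
    unfolding split_beta by (rule measurable_fun_upd[where J=I]) (use \<open>i \<in> I\<close> in auto)
  have distr: "distr (M i \<Otimes>\<^sub>M PiM I M) (PiM I M) (\<lambda>(y, z). z(i := y)) = PiM I M"
    using distr_pair_PiM_eq_PiM[of I M i] M \<open>i \<in> I\<close> unfolding ins by auto
  have "integrable (distr (M i \<Otimes>\<^sub>M PiM I M) (PiM I M) (\<lambda>(y, z). z(i := y))) G"
    using G by (simp add: distr)
  then have int: "integrable (M i \<Otimes>\<^sub>M PiM I M) (\<lambda>(y, z). G (z(i := y)))"
    using upd by (subst (asm) integrable_distr_eq) (use G in \<open>auto simp: case_prod_beta'\<close>)
  have "(\<integral>z. G z \<partial>PiM I M) = (\<integral>z. G z \<partial>distr (M i \<Otimes>\<^sub>M PiM I M) (PiM I M) (\<lambda>(y, z). z(i := y)))"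
    by (simp add: distr)
  also have "\<dots> = (\<integral>u. (case u of (y, z) \<Rightarrow> G (z(i := y))) \<partial>(M i \<Otimes>\<^sub>M PiM I M))"
    using upd by (subst integral_distr) (use G in \<open>auto simp: case_prod_beta'\<close>)
  finally show ?thesis
    using integral_fst'[OF int] by simp
qed

text \<open>A bijection onto \<open>A\<close> and one between the complements are glued. Such a
  \<open>p\<close> reduces an arbitrary index set to the initial segment of the same size.\<close>

lemma permutes_image_initial_segment:
  assumes "A \<subseteq> {1..q}"
  obtains p :: "nat \<Rightarrow> nat" where "p permutes {1..q}" "p ` {1..card A} = A"
proof -
  let ?J = "{1..card A}" and ?S = "{1..q}"
  have fin: "finite A" using assms finite_subset by blast
  have J: "?J \<subseteq> ?S" using card_mono[OF _ assms] by auto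
  obtain f where f: "bij_betw f ?J A"
    using fin by (metis card_atLeastAtMost diff_Suc_1 finite_atLeastAtMost finite_same_card_bij)
  have "card (?S - ?J) = card (?S - A)"
    using assms fin J by (simp add: card_Diff_subset)
  then obtain g where g: "bij_betw g (?S - ?J) (?S - A)"
    by (metis finite_Diff finite_atLeastAtMost finite_same_card_bij)
  define p where "p i = (if i \<in> ?J then f i else if i \<in> ?S then g i else i)" for i
  have pf: "bij_betw p ?J A"
    using f by (subst bij_betw_cong[where g=f]) (auto simp: p_def)
  have pg: "bij_betw p (?S - ?J) (?S - A)"
    using g by (subst bij_betw_cong[where g=g]) (auto simp: p_def)
  have "bij_betw p (?J \<union> (?S - ?J)) (A \<union> (?S - A))"
    by (rule bij_betw_combine[OF pf pg]) auto
  then have "bij_betw p ?S ?S"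
    using J assms by (simp add: Un_absorb1)
  then have "p permutes ?S"
    by (rule bij_imp_permutes) (use J in \<open>auto simp: p_def\<close>)
  then show ?thesis using pf that by (auto simp: bij_betw_def)
qed

section \<open>A bounded symmetric kernel and its partial means\<close>

locale bounded_symmetric_kernel =
  fixes E \<eta> :: "'e measure" and q :: nat and F :: "(nat \<Rightarrow> 'e) \<Rightarrow> real"
  assumes prob_\<eta>: "prob_space \<eta>" and sets_\<eta>: "sets \<eta> = sets E"
    and F: "F \<in> bounded_sym E q"
begin

declare One_nat_def [simp del]

abbreviation "\<eta>q \<equiv> PiM {1..q} (\<lambda>_. \<eta>)"

sublocale \<eta>: prob_space \<eta> by (rule prob_\<eta>)

sublocale \<eta>q: prob_space "\<eta>q" by (rule prob_space_PiM) (rule prob_\<eta>)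

lemma space_\<eta>: "space \<eta> = space E"
  using sets_\<eta> by (rule sets_eq_imp_space_eq)

lemma sets_PiM_\<eta>: "sets (PiM I (\<lambda>_. \<eta>)) = sets (PiM I (\<lambda>_. E))"
  by (rule sets_PiM_cong) (auto simp: sets_\<eta>)

lemma measurable_F: "F \<in> borel_measurable (power_space E q)"
  using F by (simp add: bounded_sym_def)

lemma measurable_F': "F \<in> borel_measurable \<eta>q"
  using measurable_F by (simp cong: measurable_cong_sets add: sets_PiM_\<eta>)

text \<open>Any bound serves: it yields integrability and boundedness of the canonical kernels,
  while the rate of convergence comes from the moment hypothesis.\<close>

definition F_bound :: real where
  "F_bound = (SOME c. \<forall>x\<in>space (power_space E q). \<bar>F x\<bar> \<le> c)"

lemma F_bound: "x \<in> space (power_space E q) \<Longrightarrow> \<bar>F x\<bar> \<le> F_bound"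
proof -
  have "\<exists>c. \<forall>x\<in>space (power_space E q). \<bar>F x\<bar> \<le> c"
    using F by (auto simp: bounded_sym_def bounded_iff)
  from someI_ex[OF this] show "x \<in> space (power_space E q) \<Longrightarrow> \<bar>F x\<bar> \<le> F_bound"
    unfolding F_bound_def by blast
qed

lemma F_permute: "p permutes {1..q} \<Longrightarrow> x \<in> space (power_space E q) \<Longrightarrow> F (x \<circ> p) = F x"
  using F by (simp add: bounded_sym_def symmetric_on_def)

text \<open>
  All partial means integrate over the full power \<open>\<eta>\<^sup>q\<close>: the coordinates in \<open>B\<close> are overwritten by \<open>x\<close>, so
  the same measure serves for every \<open>B\<close>.
\<close>

definition mix :: "nat set \<Rightarrow> (nat \<Rightarrow> 'e) \<Rightarrow> (nat \<Rightarrow> 'e) \<Rightarrow> nat \<Rightarrow> 'e" where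
  "mix B x y = (\<lambda>i\<in>{1..q}. if i \<in> B then x i else y i)"

definition partial_mean :: "nat set \<Rightarrow> (nat \<Rightarrow> 'e) \<Rightarrow> real" where
  "partial_mean B x = (\<integral>y. F (mix B x y) \<partial>\<eta>q)"

text \<open>
  The Moebius transform of the partial means over subsets; \<open>canonical {1..j}\<close> is the canonical
  kernel \<open>h\<^sup>(\<^sup>j\<^sup>)\<close> of the Hoeffding decomposition. It reads only the coordinates in its index set, so it
  is at the same time a function on \<open>E\<^sup>j\<close> and on \<open>E\<^sup>q\<close>.
\<close>

definition canonical :: "nat set \<Rightarrow> (nat \<Rightarrow> 'e) \<Rightarrow> real" where
  "canonical A x = (-1) ^ card A * (\<Sum>B\<in>Pow A. (-1) ^ card B * partial_mean B x)"

lemma mix_in_space: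
  assumes "\<And>i. i \<in> B \<Longrightarrow> x i \<in> space E" "y \<in> space \<eta>q"
  shows "mix B x y \<in> space (power_space E q)"
  using assms by (auto simp: mix_def space_PiM PiE_iff space_\<eta>)

lemma mix_cong: "(\<And>i. i \<in> B \<Longrightarrow> x i = x' i) \<Longrightarrow> mix B x y = mix B x' y"
  by (auto simp: mix_def fun_eq_iff)

text \<open>The index set \<open>I\<close> is left free so that a function reading only the
  coordinates in \<open>B\<close> can be treated as measurable on E^B, E^j or E^q.\<close>

lemma measurable_mix_pair:
  assumes "B \<subseteq> I"
  shows "(\<lambda>(x, y). mix B x y) \<in> measurable (PiM I (\<lambda>_. E) \<Otimes>\<^sub>M \<eta>q) (power_space E q)"
  unfolding mix_def split_beta
proof (rule measurable_restrict)
  fix i assume i: "i \<in> {1..q}"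
  show "(\<lambda>u. if i \<in> B then fst u i else snd u i) \<in> measurable (PiM I (\<lambda>_. E) \<Otimes>\<^sub>M \<eta>q) E"
  proof (cases "i \<in> B")
    case True
    then have "i \<in> I" using assms by auto
    then show ?thesis using True
      by (simp add: measurable_compose[OF measurable_fst measurable_component_singleton])
  next
    case False
    have "(\<lambda>u. snd u i) \<in> measurable (PiM I (\<lambda>_. E) \<Otimes>\<^sub>M \<eta>q) \<eta>"
      using i by (intro measurable_compose[OF measurable_snd measurable_component_singleton])
    then show ?thesis using False by (simp cong: measurable_cong_sets add: sets_\<eta>)
  qed
qed

lemma measurable_mix:
  assumes "\<And>i. i \<in> B \<Longrightarrow> x i \<in> space E"
  shows "mix B x \<in> measurable \<eta>q (power_space E q)"
proof -
  \<comment> \<open>\<open>x\<close> may take any values outside \<open>B\<close>; its restriction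
    is a point of the product, and \<open>mix B\<close> does not see the difference.\<close>
  have "restrict x B \<in> space (PiM B (\<lambda>_. E))"
    using assms by (auto simp: space_PiM PiE_iff)
  then have "(\<lambda>y. (\<lambda>(x, y). mix B x y) (restrict x B, y)) \<in> measurable \<eta>q (power_space E q)"
    by (intro measurable_compose[OF measurable_Pair1' measurable_mix_pair]) auto
  moreover have "mix B (restrict x B) = mix B x"
    by (intro ext mix_cong) auto
  ultimately show ?thesis by simp
qed

lemma integrable_F_mix:
  assumes "\<And>i. i \<in> B \<Longrightarrow> x i \<in> space E"
  shows "integrable \<eta>q (\<lambda>y. F (mix B x y))"
  using assms
  by (intro \<eta>q.integrable_const_bound[where B=F_bound] AE_I2)
     (auto intro!: F_bound mix_in_space measurable_compose[OF measurable_mix measurable_F])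

lemma measurable_partial_mean:
  assumes "B \<subseteq> I"
  shows "partial_mean B \<in> borel_measurable (PiM I (\<lambda>_. E))"
proof -
  have "(\<lambda>(x, y). F (mix B x y)) \<in> borel_measurable (PiM I (\<lambda>_. E) \<Otimes>\<^sub>M \<eta>q)"
    using measurable_compose[OF measurable_mix_pair[OF assms] measurable_F] by (simp add: split_beta)
  then show ?thesis
    unfolding partial_mean_def by (rule \<eta>q.borel_measurable_lebesgue_integral)
qed

lemma abs_partial_mean_le:
  assumes "\<And>i. i \<in> B \<Longrightarrow> x i \<in> space E"
  shows "\<bar>partial_mean B x\<bar> \<le> F_bound"
proof -
  have "\<bar>partial_mean B x\<bar> \<le> (\<integral>y. \<bar>F (mix B x y)\<bar> \<partial>\<eta>q)"
    unfolding partial_mean_def by (rule integral_abs_bound)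
  also have "\<dots> \<le> (\<integral>y. F_bound \<partial>\<eta>q)"
    using assms by (intro integral_mono integrable_abs integrable_F_mix F_bound mix_in_space) auto
  also have "\<dots> = F_bound" by (simp add: \<eta>q.prob_space)
  finally show ?thesis .
qed

lemma partial_mean_cong: "(\<And>i. i \<in> B \<Longrightarrow> x i = x' i) \<Longrightarrow> partial_mean B x = partial_mean B x'"
  unfolding partial_mean_def using mix_cong[of B x x'] by simp

lemma partial_mean_full:
  assumes "x \<in> space (power_space E q)"
  shows "partial_mean {1..q} x = F x"
proof -
  have "mix {1..q} x y = x" for y
    using assms by (auto simp: mix_def space_PiM PiE_iff extensional_def fun_eq_iff)
  then show ?thesis by (simp add: partial_mean_def \<eta>q.prob_space)
qed

lemma partial_mean_empty: "partial_mean {} x = mean_value \<eta> q F"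
  unfolding partial_mean_def mean_value_def
proof (intro Bochner_Integration.integral_cong refl)
  fix y assume "y \<in> space \<eta>q"
  then have "mix {} x y = y"
    by (auto simp: mix_def space_PiM PiE_iff extensional_def fun_eq_iff)
  then show "F (mix {} x y) = F y" by simp
qed

text \<open>Coordinate 1 of the sample from \<eta>^q is overwritten, and the marginal on the other
  coordinates is the product over \<open>{2..q}\<close> that appears in
  \<open>first_proj\<close>.\<close>

lemma partial_mean_1:
  assumes "q \<ge> 1" "x 1 \<in> space E"
  shows "partial_mean {1} x = first_proj \<eta> q F (x 1)"
proof -
  let ?R = "PiM {2..q} (\<lambda>_. \<eta>)"
  \<comment> \<open>Reindexing along the inclusion of \<open>{2..q}\<close> into
    \<open>{1..q}\<close> is the passage to the marginal.\<close>
  have R: "distr \<eta>q ?R (\<lambda>\<omega>. \<lambda>n\<in>{2..q}. \<omega> n) = ?R"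
    using distr_PiM_reindex[of "{1..q}" "\<lambda>_. \<eta>" "\<lambda>n. n" "{2..q}"] prob_\<eta> by auto
  have upd: "(\<lambda>y. y(1 := x 1)) \<in> measurable ?R \<eta>q"
    by (rule measurable_fun_upd[where J="{2..q}"]) (use assms in \<open>auto simp: space_\<eta>\<close>)
  have "first_proj \<eta> q F (x 1) = (\<integral>y. F (y(1 := x 1)) \<partial>distr \<eta>q ?R (\<lambda>\<omega>. \<lambda>n\<in>{2..q}. \<omega> n))"
    by (simp add: first_proj_def R)
  also have "\<dots> = (\<integral>\<omega>. F ((\<lambda>n\<in>{2..q}. \<omega> n)(1 := x 1)) \<partial>\<eta>q)"
    by (intro integral_distr measurable_compose[OF upd measurable_F'] measurable_restrict
        measurable_component_singleton) auto
  also have "\<dots> = partial_mean {1} x"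
    unfolding partial_mean_def
    by (intro Bochner_Integration.integral_cong refl arg_cong[where f=F])
       (use \<open>q \<ge> 1\<close> in \<open>auto simp: mix_def fun_eq_iff\<close>)
  finally show ?thesis by simp
qed

text \<open>Two invariances combine: \<eta>^q is unchanged when coordinates are permuted, and
  \<open>F\<close> is symmetric. The index set moves to its image because (x o p) i = x (p
  i).\<close>

lemma partial_mean_permute:
  assumes p: "p permutes {1..q}" and x: "\<And>i. i \<in> p ` B \<Longrightarrow> x i \<in> space E"
  shows "partial_mean B (x \<circ> p) = partial_mean (p ` B) x"
proof -
  have distr: "distr \<eta>q \<eta>q (\<lambda>y. \<lambda>n\<in>{1..q}. y (p n)) = \<eta>q"
    using distr_PiM_reindex[of "{1..q}" "\<lambda>_. \<eta>" p "{1..q}"] prob_\<eta> permutes_inj_on[OF p]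
      permutes_in_image[OF p] by auto
  have "partial_mean B (x \<circ> p)
      = (\<integral>y. F (mix B (x \<circ> p) y) \<partial>distr \<eta>q \<eta>q (\<lambda>y. \<lambda>n\<in>{1..q}. y (p n)))"
    unfolding distr partial_mean_def ..
  also have "\<dots> = (\<integral>y. F (mix B (x \<circ> p) (\<lambda>n\<in>{1..q}. y (p n))) \<partial>\<eta>q)"
    using x permutes_in_image[OF p]
    by (intro integral_distr measurable_compose[OF measurable_mix measurable_F] measurable_restrict
        measurable_component_singleton) auto
  also have "\<dots> = (\<integral>y. F (mix (p ` B) x y) \<partial>\<eta>q)"
  proof (intro Bochner_Integration.integral_cong refl)
    fix y assume y: "y \<in> space \<eta>q"
    \<comment> \<open>With the sample permuted as well, the whole argument of \<open>F\<close> is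
      one point composed with \<open>p\<close>, and symmetry removes \<open>p\<close>.\<close>
    have "mix B (x \<circ> p) (\<lambda>n\<in>{1..q}. y (p n)) = mix (p ` B) x y \<circ> p"
      using permutes_in_image[OF p] permutes_inj[OF p]
      by (auto simp: mix_def fun_eq_iff inj_image_mem_iff)
    then show "F (mix B (x \<circ> p) (\<lambda>n\<in>{1..q}. y (p n))) = F (mix (p ` B) x y)"
      using F_permute[OF p mix_in_space[of "p ` B" x y]] x y by auto
  qed
  finally show ?thesis by (simp add: partial_mean_def)
qed

text \<open>Writing y into slot i of the fixed point amounts to writing it into slot i of the
  integration variable, and resampling that coordinate does not change the integral.\<close>

lemma integral_partial_mean_insert:
  assumes "i \<in> {1..q}" "i \<notin> B" and x: "\<And>k. k \<in> B \<Longrightarrow> x k \<in> space E"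
  shows "(\<integral>y. partial_mean (insert i B) (x(i := y)) \<partial>\<eta>) = partial_mean B x"
proof -
  have "mix (insert i B) (x(i := y)) z = mix B x (z(i := y))" for y z
    using assms by (auto simp: mix_def fun_eq_iff)
  then show ?thesis
    unfolding partial_mean_def
    using integral_PiM_resample[of "{1..q}" "\<lambda>_. \<eta>" i "\<lambda>y. F (mix B x y)"] assms prob_\<eta>
    by (simp add: integrable_F_mix)
qed

section \<open>Canonical kernels\<close>

lemma canonical_cong: "(\<And>i. i \<in> A \<Longrightarrow> x i = x' i) \<Longrightarrow> canonical A x = canonical A x'"
  unfolding canonical_def
  by (intro arg_cong2[where f="(*)"] sum.cong refl partial_mean_cong) auto

lemma measurable_canonical:
  "A \<subseteq> I \<Longrightarrow> canonical A \<in> borel_measurable (PiM I (\<lambda>_. E))"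
  unfolding canonical_def
  by (intro borel_measurable_times borel_measurable_sum borel_measurable_const measurable_partial_mean) auto

lemma abs_canonical_le:
  assumes "\<And>i. i \<in> A \<Longrightarrow> x i \<in> space E"
  shows "\<bar>canonical A x\<bar> \<le> real (card (Pow A)) * F_bound"
proof -
  have "\<bar>canonical A x\<bar> = \<bar>\<Sum>B\<in>Pow A. (-1) ^ card B * partial_mean B x\<bar>"
    by (simp add: canonical_def abs_mult power_abs)
  also have "\<dots> \<le> (\<Sum>B\<in>Pow A. F_bound)"
    using assms by (intro order_trans[OF sum_abs] sum_mono)
      (auto simp: abs_mult power_abs intro!: abs_partial_mean_le)
  finally show ?thesis by simp
qed

text \<open>Direct images under \<open>p\<close> map the subsets of \<open>A\<close> bijectively to
  those of the image of \<open>A\<close> and preserve cardinality, hence signs; the partial means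
  match term by term.\<close>

lemma canonical_permute:
  assumes p: "p permutes {1..q}" and x: "\<And>i. i \<in> p ` A \<Longrightarrow> x i \<in> space E"
  shows "canonical A (x \<circ> p) = canonical (p ` A) x"
proof -
  have card: "card (p ` B) = card B" for B
    by (rule card_image[OF permutes_inj_on[OF p]])
  have "inj_on ((`) p) (Pow A)"
    using permutes_inj[OF p] by (simp add: inj_on_def inj_image_eq_iff)
  then have "(\<Sum>B\<in>Pow (p ` A). (-1) ^ card B * partial_mean B x)
      = (\<Sum>B\<in>Pow A. (-1) ^ card (p ` B) * partial_mean (p ` B) x)"
    by (simp add: image_Pow_surj[OF refl, symmetric] sum.reindex)
  also have "\<dots> = (\<Sum>B\<in>Pow A. (-1) ^ card B * partial_mean B (x \<circ> p))"
    using x by (intro sum.cong refl) (subst partial_mean_permute[OF p], auto simp: card)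
  finally show ?thesis by (simp add: canonical_def card)
qed

text \<open>The subsets of \<open>A\<close> are paired as \<open>B\<close> and
  \<open>insert i B\<close> with i outside \<open>B\<close>. Integrated over coordinate i, both give
  the partial mean over \<open>B\<close>, with opposite signs. The condition on \<open>x\<close>
  leaves out i because in \<open>B0_sym\<close> the point comes from E^(j-1).\<close>

lemma integral_canonical_eq_0:
  assumes "i \<in> A" "A \<subseteq> {1..q}" and x: "\<And>k. k \<in> A - {i} \<Longrightarrow> x k \<in> space E"
  shows "(\<integral>y. canonical A (x(i := y)) \<partial>\<eta>) = 0"
proof -
  define A' where "A' = A - {i}"
  have A: "A = insert i A'" "i \<notin> A'" and fin: "finite A'"
    using assms finite_subset[of A "{1..q}"] by (auto simp: A'_def)
  have sp: "(x(i := y)) k \<in> space E" if "y \<in> space \<eta>" "k \<in> A" for y k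
    using that x by (auto simp: space_\<eta>)
  \<comment> \<open>Measurability in y is obtained for the restriction to \<open>A\<close>, which is
    a point of the product; partial means over subsets of \<open>A\<close> take the same value
    there.\<close>
  have upd: "(\<lambda>y. restrict (x(i := y)) A) \<in> measurable \<eta> (PiM A (\<lambda>_. E))"
  proof (rule measurable_restrict)
    fix k assume "k \<in> A"
    then show "(\<lambda>y. (x(i := y)) k) \<in> measurable \<eta> E"
      using x by (cases "k = i") (auto simp: measurable_ident_sets[OF sets_\<eta>])
  qed
  have int: "integrable \<eta> (\<lambda>y. partial_mean B (x(i := y)))" if "B \<subseteq> A" for B
  proof (rule \<eta>.integrable_const_bound[where B=F_bound])
    show "AE y in \<eta>. norm (partial_mean B (x(i := y))) \<le> F_bound"
      using that sp by (intro AE_I2) (auto intro!: abs_partial_mean_le)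
    have "(\<lambda>y. partial_mean B (restrict (x(i := y)) A)) \<in> borel_measurable \<eta>"
      using measurable_compose[OF upd measurable_partial_mean[OF that]] .
    moreover have "partial_mean B (restrict (x(i := y)) A) = partial_mean B (x(i := y))" for y
      using that by (intro partial_mean_cong) auto
    ultimately show "(\<lambda>y. partial_mean B (x(i := y))) \<in> borel_measurable \<eta>" by simp
  qed
  have "(\<integral>y. (\<Sum>B\<in>Pow A. (-1) ^ card B * partial_mean B (x(i := y))) \<partial>\<eta>)
      = (\<Sum>B\<in>Pow A. (-1) ^ card B * (\<integral>y. partial_mean B (x(i := y)) \<partial>\<eta>))"
    using int by (subst Bochner_Integration.integral_sum) auto
  also have "\<dots> = (\<Sum>B\<in>Pow A'. (-1) ^ card B * (\<integral>y. partial_mean B (x(i := y)) \<partial>\<eta>))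
      + (\<Sum>B\<in>Pow A'. (-1) ^ card (insert i B) * (\<integral>y. partial_mean (insert i B) (x(i := y)) \<partial>\<eta>))"
  proof -
    have "inj_on (insert i) (Pow A')"
      using A(2) by (auto simp: inj_on_def)
    moreover have "Pow A' \<inter> insert i ` Pow A' = {}"
      using A(2) by auto
    ultimately show ?thesis
      unfolding A(1) Pow_insert using fin by (subst sum.union_disjoint) (auto simp: sum.reindex)
  qed
  also have "\<dots> = (\<Sum>B\<in>Pow A'. (-1) ^ card B * partial_mean B x)
      + (\<Sum>B\<in>Pow A'. - ((-1) ^ card B * partial_mean B x))"
  proof (intro arg_cong2[where f="(+)"] sum.cong refl)
    fix B assume B: "B \<in> Pow A'"
    then have i: "i \<notin> B" and finB: "finite B" using A(2) fin finite_subset by auto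
    then have "partial_mean B (x(i := y)) = partial_mean B x" for y
      by (intro partial_mean_cong) auto
    then show "(-1) ^ card B * (\<integral>y. partial_mean B (x(i := y)) \<partial>\<eta>) = (-1) ^ card B * partial_mean B x"
      by (simp add: \<eta>.prob_space)
    have "(\<integral>y. partial_mean (insert i B) (x(i := y)) \<partial>\<eta>) = partial_mean B x"
      using assms i B x by (intro integral_partial_mean_insert) (auto simp: A'_def)
    then show "(-1) ^ card (insert i B) * (\<integral>y. partial_mean (insert i B) (x(i := y)) \<partial>\<eta>)
        = - ((-1) ^ card B * partial_mean B x)"
      using i finB by simp
  qed
  finally show ?thesis by (simp add: canonical_def sum_negf)
qed

text \<open>This admits the canonical kernels to the second moment hypothesis. The vanishing
  integral over the last coordinate is the cancellation above with i = j.\<close>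

lemma canonical_in_B0_sym:
  assumes "1 \<le> j" "j \<le> q"
  shows "canonical {1..j} \<in> B0_sym E \<eta> j"
proof -
  have "bounded (canonical {1..j} ` space (power_space E j))"
    unfolding bounded_iff
    by (intro exI[of _ "real (card (Pow {1..j})) * F_bound"])
       (auto simp del: card_Pow intro!: abs_canonical_le simp: space_PiM)
  moreover have "symmetric_on E j (canonical {1..j})"
    unfolding symmetric_on_def
  proof (intro allI impI)
    fix p x assume p: "p permutes {1..j}" and x: "x \<in> space (power_space E j)"
    \<comment> \<open>A permutation of \<open>{1..j}\<close> fixes the remaining indices, so it also
      permutes \<open>{1..q}\<close>, where the symmetry of \<open>F\<close> is available.\<close>
    have "p permutes {1..q}" using p assms by (rule_tac permutes_subset) auto
    then show "canonical {1..j} (x \<circ> p) = canonical {1..j} x"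
      using canonical_permute[of p "{1..j}" x] x unfolding permutes_image[OF p]
      by (auto simp: space_PiM PiE_iff)
  qed
  moreover have "(\<integral>y. canonical {1..j} (x(j := y)) \<partial>\<eta>) = 0"
    if "x \<in> space (power_space E (j - 1))" for x
    using that assms by (intro integral_canonical_eq_0) (auto simp: space_PiM PiE_iff)
  ultimately show ?thesis
    by (simp add: B0_sym_def bounded_sym_def measurable_canonical)
qed

text \<open>Moebius inversion on the subsets of \<open>{1..q}\<close>: the signed subset sum is its
  own inverse, and the partial mean over all coordinates is \<open>F\<close>. The outer sign in
  \<open>canonical\<close> is the one that the inversion formula attaches to each subset.\<close>

lemma sum_canonical:
  assumes "x \<in> space (power_space E q)"
  shows "F x = (\<Sum>A\<in>Pow {1..q}. canonical A x)"
proof -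
  have "partial_mean {1..q} x = (\<Sum>A\<in>Pow {1..q}. (-1) ^ card A *
      (\<Sum>B\<in>Pow A. (-1) ^ card B * partial_mean B x))"
    by (rule inclusion_exclusion_symmetric) auto
  then show ?thesis using assms by (simp add: partial_mean_full canonical_def)
qed

lemma canonical_empty: "canonical {} x = mean_value \<eta> q F"
  by (simp add: canonical_def partial_mean_empty)

text \<open>Of the two subsets, the empty one contributes minus the mean and \<open>{1}\<close>
  contributes the first projection.\<close>

lemma canonical_1:
  assumes "q \<ge> 1" "x 1 \<in> space E"
  shows "canonical {1} x = centred_proj \<eta> q F (x 1)"
proof -
  have "Pow {1::nat} = {{}, {1}}" by auto
  then show ?thesis
    using partial_mean_1[of x] assms by (simp add: canonical_def partial_mean_empty centred_proj_def)
qed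

text \<open>Measurability is inherited from the canonical kernel of \<open>{1}\<close>, evaluated at
  one-coordinate points.\<close>

lemma measurable_centred_proj:
  assumes "q \<ge> 1"
  shows "centred_proj \<eta> q F \<in> borel_measurable E"
proof -
  have "(\<lambda>y. canonical {1} (\<lambda>k\<in>{1}. y)) \<in> borel_measurable E"
    by (rule measurable_compose[OF _ measurable_canonical[of "{1}" "{1}"]])
       (auto intro!: measurable_restrict)
  then show ?thesis
    by (rule measurable_cong[THEN iffD1, rotated]) (use assms in \<open>simp add: canonical_1\<close>)
qed

section \<open>Sample averages of the canonical kernels\<close>

text \<open>A permutation carries \<open>{1..card A}\<close> to \<open>A\<close> and preserves the
  average; the kernel of the initial segment does not read coordinates beyond \<open>card A\<close>,
  and these are averaged out.\<close>

lemma empirical_odot_canonical: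
  assumes x: "\<And>i. i \<in> {1..N} \<Longrightarrow> x i \<in> space E" and A: "A \<subseteq> {1..q}" and "q \<le> N"
  shows "empirical_odot N x q (canonical A) = empirical_odot N x (card A) (canonical {1..card A})"
proof -
  obtain p where p: "p permutes {1..q}" "p ` {1..card A} = A"
    using permutes_image_initial_segment[OF A] .
  have "empirical_odot N x q (canonical A)
      = empirical_odot N x q (\<lambda>y. canonical {1..card A} (y \<circ> p))"
    using x
  proof (rule empirical_odot_cong)
    fix y assume "y \<in> space (power_space E q)"
    then have "y i \<in> space E" if "i \<in> A" for i
      using that A by (auto simp: space_PiM PiE_iff)
    then show "canonical A y = canonical {1..card A} (y \<circ> p)"
      using canonical_permute[OF p(1), of "{1..card A}" y] unfolding p(2) by simp
  qed
  also have "\<dots> = empirical_odot N x q (canonical {1..card A})"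
    using p(1) by (rule empirical_odot_permute)
  also have "\<dots> = empirical_odot N x (card A) (canonical {1..card A})"
    using card_mono[OF _ A] \<open>q \<le> N\<close> by (intro empirical_odot_marginal canonical_cong) auto
  finally show ?thesis .
qed

text \<open>The expansion of \<open>F\<close> is averaged term by term and grouped into the empty
  set, the singletons and the larger sets. The remainder stays indexed by sets rather than sizes,
  which avoids binomial coefficients.\<close>

lemma hoeffding_decomposition:
  assumes x: "\<And>i. i \<in> {1..N} \<Longrightarrow> x i \<in> space E" and "1 \<le> q" "q \<le> N"
  shows "empirical_odot N x q F - mean_value \<eta> q F
    = real q * (\<integral>y. centred_proj \<eta> q F y \<partial>empirical_measure E N x)
      + (\<Sum>A | A \<subseteq> {1..q} \<and> card A \<ge> 2. empirical_odot N x (card A) (canonical {1..card A}))"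
proof -
  let ?U = "\<lambda>A. empirical_odot N x (card A) (canonical {1..card A})"
  let ?T = "{A. A \<subseteq> {1..q} \<and> card A \<ge> 2}"
  have "empirical_odot N x q F = empirical_odot N x q (\<lambda>y. \<Sum>A\<in>Pow {1..q}. canonical A y)"
    using x sum_canonical by (rule empirical_odot_cong)
  also have "\<dots> = (\<Sum>A\<in>Pow {1..q}. ?U A)"
    unfolding empirical_odot_sum using x \<open>q \<le> N\<close>
    by (intro sum.cong refl empirical_odot_canonical) auto
  also have "Pow {1..q} = insert {} ((\<lambda>i. {i}) ` {1..q} \<union> ?T)"
  proof -
    have "A \<in> insert {} ((\<lambda>i. {i}) ` {1..q} \<union> ?T)" if "A \<subseteq> {1..q}" for A
    proof -
      have "finite A" using that finite_subset by blast
      then consider "A = {}" | i where "A = {i}" | "card A \<ge> 2"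
        by (metis One_nat_def Suc_1 card_1_singletonE card_0_eq less_2_cases not_less)
      then show ?thesis using that by cases auto
    qed
    then show ?thesis by auto
  qed
  also have "(\<Sum>A\<in>\<dots>. ?U A) = ?U {} + ((\<Sum>i\<in>{1..q}. ?U {i}) + (\<Sum>A\<in>?T. ?U A))"
  proof -
    have fin: "finite ?T" by (rule finite_subset[of _ "Pow {1..q}"]) auto
    have disj: "(\<lambda>i. {i}) ` {1..q} \<inter> ?T = {}" by auto
    have "(\<Sum>A\<in>(\<lambda>i. {i}) ` {1..q}. ?U A) = (\<Sum>i\<in>{1..q}. ?U {i})"
      by (subst sum.reindex) (auto simp: inj_on_def)
    then have "(\<Sum>A\<in>(\<lambda>i. {i}) ` {1..q} \<union> ?T. ?U A) = (\<Sum>i\<in>{1..q}. ?U {i}) + (\<Sum>A\<in>?T. ?U A)"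
      using sum.union_disjoint[OF _ fin disj, of ?U] by simp
    moreover have "{} \<notin> (\<lambda>i. {i}) ` {1..q} \<union> ?T" by auto
    ultimately show ?thesis
      using fin by (subst sum.insert) auto
  qed
  also have "?U {} = mean_value \<eta> q F"
    by (simp add: canonical_empty empirical_odot_def)
  also have "(\<Sum>i\<in>{1..q}. ?U {i}) = real q * (\<integral>y. centred_proj \<eta> q F y \<partial>empirical_measure E N x)"
  proof -
    have "N \<ge> 1" using assms by simp
    have "empirical_odot N x 1 (canonical {1}) = (\<Sum>i\<in>{1..N}. centred_proj \<eta> q F (x i)) / real N"
      using \<open>1 \<le> q\<close> x unfolding empirical_odot_1[OF \<open>N \<ge> 1\<close>]
      by (intro arg_cong2[where f="(/)"] sum.cong refl) (simp add: canonical_1)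
    also have "\<dots> = (\<integral>y. centred_proj \<eta> q F y \<partial>empirical_measure E N x)"
      using \<open>N \<ge> 1\<close> x measurable_centred_proj[OF \<open>1 \<le> q\<close>] by (rule integral_empirical_measure[symmetric])
    finally have "?U {i} = (\<integral>y. centred_proj \<eta> q F y \<partial>empirical_measure E N x)" for i
      by (simp add: is_singleton_altdef[THEN iffD1, OF is_singletonI])
    then show ?thesis by simp
  qed
  finally show ?thesis by simp
qed

end

section \<open>Asymptotic normality\<close>

theorem theorem3p1:
  fixes E \<eta> :: "'e measure"
    and P :: "nat \<Rightarrow> 'w measure"
    and \<xi> :: "nat \<Rightarrow> nat \<Rightarrow> 'w \<Rightarrow> 'e"
    and q :: nat
    and F :: "(nat \<Rightarrow> 'e) \<Rightarrow> real"
    and \<sigma>2 :: real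
  assumes "prob_space \<eta>" and "sets \<eta> = sets E"
    and "\<And>N. N \<ge> 1 \<Longrightarrow> prob_space (P N)"
    and "\<And>N i. N \<ge> 1 \<Longrightarrow> i \<in> {1..N} \<Longrightarrow> \<xi> N i \<in> measurable (P N) E"
    and "q \<ge> 1"
    and "F \<in> bounded_sym E q"
    and "\<exists>C :: nat \<Rightarrow> real \<Rightarrow> real. \<forall>j\<ge>2. \<forall>f \<in> B0_sym E \<eta> j. \<forall>N\<ge>j.
           (\<integral>\<omega>. (empirical_odot N (\<lambda>i. \<xi> N i \<omega>) j f)\<^sup>2 \<partial>(P N))
             \<le> C j (sup_norm E j f) / real N ^ j"
    and "\<sigma>2 \<ge> 0"
    and "weak_conv_m
           (\<lambda>N. distr (P N) borel
              (\<lambda>\<omega>. sqrt (real N) * (\<integral>x. centred_proj \<eta> q F x \<partial>(empirical_measure E N (\<lambda>i. \<xi> N i \<omega>)))))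
           (normal_law 0 \<sigma>2)"
  shows "weak_conv_m
           (\<lambda>N. distr (P N) borel
              (\<lambda>\<omega>. sqrt (real N) * (empirical_odot N (\<lambda>i. \<xi> N i \<omega>) q F - mean_value \<eta> q F)))
           (normal_law 0 ((real q)\<^sup>2 * \<sigma>2))"
proof -
  interpret bounded_symmetric_kernel E \<eta> q F
    using assms(1,2,6) by (rule bounded_symmetric_kernel.intro)
  define X where "X N \<omega> = sqrt (real N) * (empirical_odot N (\<lambda>i. \<xi> N i \<omega>) q F - mean_value \<eta> q F)" for N \<omega>
  define Y where "Y N \<omega> = sqrt (real N) *
    (\<integral>x. centred_proj \<eta> q F x \<partial>(empirical_measure E N (\<lambda>i. \<xi> N i \<omega>)))" for N \<omega>
  define U where "U N A \<omega> = empirical_odot N (\<lambda>i. \<xi> N i \<omega>) (card A) (canonical {1..card A})" for N \<omega> and A :: "nat set"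
  let ?T = "{A. A \<subseteq> {1..q} \<and> card A \<ge> 2}"
  have finT: "finite ?T" by (rule finite_subset[of _ "Pow {1..q}"]) auto
  have card_T: "card A \<le> q" "card A \<ge> 2" if "A \<in> ?T" for A
    using that card_mono[of "{1..q}" A] by auto
  obtain C where C: "\<And>j f N. 2 \<le> j \<Longrightarrow> f \<in> B0_sym E \<eta> j \<Longrightarrow> j \<le> N \<Longrightarrow>
      (\<integral>\<omega>. (empirical_odot N (\<lambda>i. \<xi> N i \<omega>) j f)\<^sup>2 \<partial>(P N)) \<le> C j (sup_norm E j f) / real N ^ j"
    using assms(7) by blast
  \<comment> \<open>The absolute value makes the bound nonnegative, as is needed to enlarge the
    fraction by lowering the power of N. \<open>K A\<close> is free of N: this is the uniformity in
    the moment hypothesis.\<close>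
  define K where "K A = \<bar>C (card A) (sup_norm E (card A) (canonical {1..card A}))\<bar>" for A :: "nat set"
  have \<xi>_space: "\<xi> N i \<omega> \<in> space E" if "N \<ge> q" "i \<in> {1..N}" "\<omega> \<in> space (P N)" for N i \<omega>
    using measurable_space[OF assms(4)] that \<open>q \<ge> 1\<close> by auto
  have measU: "U N A \<in> borel_measurable (P N)" if "N \<ge> q" for N A
    unfolding U_def using that \<open>q \<ge> 1\<close>
    by (intro borel_measurable_empirical_odot[of N "\<xi> N" "P N" E] assms(4) measurable_canonical) auto
  have measX: "X N \<in> borel_measurable (P N)" if "N \<ge> q" for N
    unfolding X_def using that \<open>q \<ge> 1\<close>
    by (intro borel_measurable_times borel_measurable_diff borel_measurable_const
        borel_measurable_empirical_odot[of N "\<xi> N" "P N" E] assms(4) measurable_F) auto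
  have measY: "Y N \<in> borel_measurable (P N)" if "N \<ge> q" for N
  proof -
    have "N \<ge> 1" using that \<open>q \<ge> 1\<close> by simp
    have "(\<lambda>\<omega>. sqrt (real N) * ((\<Sum>i\<in>{1..N}. centred_proj \<eta> q F (\<xi> N i \<omega>)) / real N)) \<in> borel_measurable (P N)"
      using assms(4)[OF \<open>N \<ge> 1\<close>]
      by (intro borel_measurable_times borel_measurable_divide borel_measurable_const borel_measurable_sum
          measurable_compose[OF _ measurable_centred_proj[OF \<open>q \<ge> 1\<close>]]) auto
    moreover have "Y N \<omega> = sqrt (real N) * ((\<Sum>i\<in>{1..N}. centred_proj \<eta> q F (\<xi> N i \<omega>)) / real N)"
      if "\<omega> \<in> space (P N)" for \<omega>
      unfolding Y_def using \<open>N \<ge> 1\<close> \<xi>_space[OF \<open>N \<ge> q\<close> _ that] measurable_centred_proj[OF \<open>q \<ge> 1\<close>]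
      by (subst integral_empirical_measure) auto
    ultimately show ?thesis by (simp cong: measurable_cong)
  qed
  \<comment> \<open>The singleton terms are exactly q times the linear statistic \<open>Y\<close>;
    only sets with at least two elements remain.\<close>
  have XY: "X N \<omega> - real q * Y N \<omega> = sqrt (real N) * (\<Sum>A\<in>?T. U N A \<omega>)"
    if "N \<ge> q" "\<omega> \<in> space (P N)" for N \<omega>
    using hoeffding_decomposition[of N "\<lambda>i. \<xi> N i \<omega>"] \<xi>_space[OF that(1) _ that(2)] that \<open>q \<ge> 1\<close>
    by (simp add: X_def Y_def U_def algebra_simps)
  \<comment> \<open>Square integrability is drawn from boundedness: the moment hypothesis cannot
    supply it, since a Bochner integral of a non-integrable function is 0.\<close>
  have intU: "integrable (P N) (U N A)" and intU2: "integrable (P N) (\<lambda>\<omega>. (U N A \<omega>)\<^sup>2)"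
    if "N \<ge> q" "A \<in> ?T" for N A
  proof -
    interpret P: prob_space "P N" using assms(3) that \<open>q \<ge> 1\<close> by auto
    let ?c = "real (card (Pow {1..card A})) * F_bound"
    have bound: "\<bar>U N A \<omega>\<bar> \<le> ?c" if "\<omega> \<in> space (P N)" for \<omega>
      unfolding U_def using \<xi>_space[OF \<open>N \<ge> q\<close> _ that] card_T[OF \<open>A \<in> ?T\<close>] \<open>N \<ge> q\<close>
      by (intro abs_empirical_odot_le[where E=E] abs_canonical_le) (auto simp: space_PiM PiE_iff)
    then show "integrable (P N) (U N A)"
      using measU[OF \<open>N \<ge> q\<close>] by (intro P.integrable_const_bound[where B="?c"] AE_I2) auto
    have "norm ((U N A \<omega>)\<^sup>2) \<le> ?c\<^sup>2" if "\<omega> \<in> space (P N)" for \<omega>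
      using power_mono[OF bound[OF that], of 2] by simp
    then show "integrable (P N) (\<lambda>\<omega>. (U N A \<omega>)\<^sup>2)"
      using measU[OF \<open>N \<ge> q\<close>] by (intro P.integrable_const_bound[where B="?c\<^sup>2"] AE_I2) auto
  qed
  have intXY: "integrable (P N) (\<lambda>\<omega>. X N \<omega> - real q * Y N \<omega>)" if "N \<ge> q" for N
  proof -
    have "integrable (P N) (\<lambda>\<omega>. sqrt (real N) * (\<Sum>A\<in>?T. U N A \<omega>))"
      using intU[OF that] by (intro integrable_mult_right Bochner_Integration.integrable_sum)
    then show ?thesis
      using XY[OF that] by (simp cong: Bochner_Integration.integrable_cong)
  qed
  have absU: "(\<integral>\<omega>. \<bar>U N A \<omega>\<bar> \<partial>P N) \<le> (K A + 1) / (2 * real N)" if "N \<ge> q" "A \<in> ?T" for N A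
  proof -
    interpret P: prob_space "P N" using assms(3) that \<open>q \<ge> 1\<close> by auto
    have N: "real N \<ge> 1" using that \<open>q \<ge> 1\<close> by simp
    have "(\<integral>\<omega>. (U N A \<omega>)\<^sup>2 \<partial>P N) \<le> C (card A) (sup_norm E (card A) (canonical {1..card A})) / real N ^ card A"
      unfolding U_def using card_T[OF that(2)] that(1) by (intro C canonical_in_B0_sym) auto
    \<comment> \<open>As N >= 1 and \<open>card A \<ge> 2\<close>, the slowest rate N^(-2) covers
      all sets at once.\<close>
    also have "\<dots> \<le> K A / real N ^ 2"
      using N card_T[OF that(2)] unfolding K_def by (intro frac_le power_increasing) auto
    finally have "real N * (\<integral>\<omega>. (U N A \<omega>)\<^sup>2 \<partial>P N) \<le> K A / real N"
      using N by (simp add: field_simps power2_eq_square)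
    \<comment> \<open>The free parameter is taken to be N, which makes both summands of the first
      moment bound of order 1/N.\<close>
    then show ?thesis
      using P.expectation_abs_le_square[OF measU[OF that(1)] intU2[OF that], of "real N"] N
      by (simp add: field_simps)
  qed
  have L1: "(\<lambda>N. \<integral>\<omega>. \<bar>X N \<omega> - real q * Y N \<omega>\<bar> \<partial>P N) \<longlonglongrightarrow> 0"
  proof (rule Lim_null_comparison)
    \<comment> \<open>The remainder is a sum of finitely many terms, their number depending on q
      only, each O(1/N) in L1; the factor sqrt N leaves the rate 1/sqrt N.\<close>
    let ?S = "\<Sum>A\<in>?T. (K A + 1) / 2"
    show "\<forall>\<^sub>F N in sequentially. norm (\<integral>\<omega>. \<bar>X N \<omega> - real q * Y N \<omega>\<bar> \<partial>P N) \<le> ?S * (1 / sqrt (real N))"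
      using eventually_ge_at_top[of q]
    proof eventually_elim
      case (elim N)
      have N: "real N > 0" using elim \<open>q \<ge> 1\<close> by simp
      have "(\<integral>\<omega>. \<bar>X N \<omega> - real q * Y N \<omega>\<bar> \<partial>P N) \<le> (\<integral>\<omega>. sqrt (real N) * (\<Sum>A\<in>?T. \<bar>U N A \<omega>\<bar>) \<partial>P N)"
      proof (rule integral_mono)
        show "integrable (P N) (\<lambda>\<omega>. \<bar>X N \<omega> - real q * Y N \<omega>\<bar>)"
          using intXY[OF elim] by (rule integrable_abs)
        show "integrable (P N) (\<lambda>\<omega>. sqrt (real N) * (\<Sum>A\<in>?T. \<bar>U N A \<omega>\<bar>))"
          using intU[OF elim]
          by (intro integrable_mult_right Bochner_Integration.integrable_sum integrable_abs)
        show "\<bar>X N \<omega> - real q * Y N \<omega>\<bar> \<le> sqrt (real N) * (\<Sum>A\<in>?T. \<bar>U N A \<omega>\<bar>)" if "\<omega> \<in> space (P N)" for \<omega>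
          using XY[OF elim that] by (simp add: abs_mult mult_left_mono)
      qed
      also have "\<dots> = sqrt (real N) * (\<Sum>A\<in>?T. \<integral>\<omega>. \<bar>U N A \<omega>\<bar> \<partial>P N)"
        using intU[OF elim] by (subst integral_mult_right_zero, subst Bochner_Integration.integral_sum) auto
      also have "\<dots> \<le> sqrt (real N) * (\<Sum>A\<in>?T. (K A + 1) / (2 * real N))"
        using absU[OF elim] by (intro mult_left_mono sum_mono) auto
      also have "\<dots> = sqrt (real N) * (?S / real N)"
        by (simp add: sum_divide_distrib)
      also have "\<dots> = ?S * (1 / sqrt (real N))"
        using N real_sqrt_mult_self[of "real N"] by (simp add: field_simps)
      finally show ?case by simp
    qed
    have "(\<lambda>N. 1 / sqrt (real N)) \<longlonglongrightarrow> 0"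
      by real_asymp
    then show "(\<lambda>N. ?S * (1 / sqrt (real N))) \<longlonglongrightarrow> 0"
      by (rule tendsto_mult_right_zero)
  qed
  have "weak_conv_m (\<lambda>N. distr (P N) borel (X N)) (distr (normal_law 0 \<sigma>2) borel (\<lambda>x. real q * x))"
  proof (rule weak_conv_m_scale_perturb[where Y=Y])
    show "weak_conv_m (\<lambda>N. distr (P N) borel (Y N)) (normal_law 0 \<sigma>2)"
      using assms(9) unfolding Y_def .
    show "real_distribution (normal_law 0 \<sigma>2)"
      using \<open>\<sigma>2 \<ge> 0\<close> by (rule real_distribution_normal_law)
    show "\<forall>\<^sub>F N in sequentially. prob_space (P N)"
      using eventually_ge_at_top[of 1] by eventually_elim (rule assms(3))
  qed (use L1 measX measY intXY in \<open>auto intro!: eventually_mono[OF eventually_ge_at_top[of q]]\<close>)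
  \<comment> \<open>\<open>q \<ge> 1\<close> makes the scaling factor nonzero, so the scaled limit
    is the normal law with variance q^2 \<open>\<sigma>2\<close>, including the Dirac mass when
    \<open>\<sigma>2\<close> is 0.\<close>
  then show ?thesis
    using \<open>q \<ge> 1\<close> \<open>\<sigma>2 \<ge> 0\<close> unfolding X_def by (simp add: distr_normal_law_scale)
qed

end
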